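(* Let $\Gamma$ be a simple non-complete connected graph such that $\operatorname{diam}(\Gamma)\leq 3$ and $\operatorname{rank}(A(\Gamma))\leq 5$, where $A(\Gamma)$ is the adjacency matrix of $\Gamma$. Then there exists a non-zero $(0,1)$-vector in the row space of $A(\Gamma)$ over $\mathbb{R}$ which does not occur as a row of $A(\Gamma)$.
   Context: For a simple graph with vertices $v_1,\dots,v_n$, the adjacency matrix $A(\Gamma)=(a_{ij})$ has $a_{ij}=1$ if $v_i$ is adjacent to $v_j$ and $a_{ij}=0$ otherwise; its rank is taken over $\mathbb{R}$. The row space is taken over the real numbers. *)

theory Defs
  imports "HOL-Analysis.Analysis" "Graph_Theory.Graph_Theory"
begin

text \<open>
  Simple graphs are the locale \<open>graph\<close> of \<open>Graph_Theory\<close>: finite digraphs without loops and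
  parallel arcs whose arc relation is symmetric, so that an undirected edge is a pair of opposite arcs.
\<close>

definition complete_graph :: "('a, 'b) pre_digraph \<Rightarrow> bool" where
  "complete_graph G \<longleftrightarrow> complete_digraph (card (verts G)) G"

text \<open>With all arc weights 1, the cost of a walk is its length; the distance between vertices in
  different components is \<open>\<infinity>\<close>, and hence so is the diameter of a disconnected graph.\<close>

definition graph_dist :: "('a, 'b) pre_digraph \<Rightarrow> 'a \<Rightarrow> 'a \<Rightarrow> ereal" where
  "graph_dist G u w = wf_digraph.\<mu> G (\<lambda>_. 1) u w"

definition diam :: "('a, 'b) pre_digraph \<Rightarrow> ereal" where
  "diam G = (SUP u\<in>verts G. SUP w\<in>verts G. graph_dist G u w)"

text \<open>The map \<open>v\<close> is the enumeration of the vertices by the index type of the matrix.\<close>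

definition adjacency_matrix :: "('a, 'b) pre_digraph \<Rightarrow> ('n::finite \<Rightarrow> 'a) \<Rightarrow> real^'n^'n" where
  "adjacency_matrix G v = (\<chi> i j. if v i \<rightarrow>\<^bsub>G\<^esub> v j then 1 else 0)"

definition row_space :: "real^'n^'m \<Rightarrow> (real^'n) set" where
  "row_space A = span (rows A)"

end

theory Submission
  imports Defs
begin

text \<open>
  A \<open>(0,1)\<close>-vector that equals 1 on a maximal clique is not a row, so it suffices to find one in the
  row space. For a clique \<open>{a, b}\<close> the sum of the two rows will do. In general, choose a
  set of vertices whose principal submatrix \<open>B\<close> is nonsingular, and let \<open>Q(x)\<close> be the value of the
  inverse form of \<open>B\<close> at the adjacency vector of \<open>x\<close>. When \<open>B\<close> has four rows, the bound 5 on
  the rank forces the Schur complement to have rank at most 1, so the residual entry at \<open>(x, y)\<close>,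
  that is \<open>A(x, y)\<close> minus the inverse form, has square \<open>Q(x) Q(y)\<close>. This leaves so few
  possibilities for the adjacencies that the required vector can be written down explicitly:
  \<open>B\<close> is the adjacency matrix of the clique when the clique has size 4, and of a triangle with
  a pendant edge when it has size 3. A 3-clique without such a pendant edge has every vertex
  adjacent to 0 or 2 of its members, and half the sum of its rows works. The rows of a 5-clique
  span the row space, and a quarter of their sum works.
\<close>

section \<open>Subspaces cut out by vanishing coordinates\<close>

text \<open>The \<open>f i\<close> are triangular with respect to the coordinates
  \<open>p i\<close>: \<open>f k\<close> satisfies the first \<open>k\<close> conditions but not the
  next one, so each condition lowers the dimension.\<close>

lemma dim_vanishing_le:
  fixes S :: "(real^'n) set" and f :: "nat \<Rightarrow> real^'n" and p :: "nat \<Rightarrow> 'n"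
  assumes "subspace S"
    and "\<forall>i<k. f i \<in> S \<and> f i $ p i \<noteq> 0 \<and> (\<forall>j<i. f i $ p j = 0)"
  shows "dim {h \<in> S. \<forall>i<k. h $ p i = 0} + k \<le> dim S"
  using assms(2)
proof (induction k)
  case 0
  then show ?case by simp
next
  case (Suc k)
  let ?T = "\<lambda>k. {h \<in> S. \<forall>i<k. h $ p i = 0}"
  have sub: "subspace (?T m)" for m
    using assms(1) by (auto simp: subspace_def)
  have "f k \<in> ?T k - ?T (Suc k)"
    using Suc.prems by auto
  moreover have "?T (Suc k) \<subseteq> ?T k" by auto
  ultimately have "?T (Suc k) \<subset> ?T k" by blast
  then have "dim (?T (Suc k)) < dim (?T k)"
    by (intro dim_psubset) (simp add: span_eq_iff[THEN iffD2, OF sub])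
  moreover have "dim (?T k) + k \<le> dim S"
    using Suc by auto
  ultimately show ?case by linarith
qed

text \<open>The vectors of \<open>S\<close> vanishing at all \<open>p i\<close> form a space of
  dimension at most 1, so \<open>g\<close> and \<open>h\<close> are proportional.\<close>

lemma vanishing_proportional:
  fixes S :: "(real^'n) set"
  assumes "subspace S" "dim S \<le> Suc k"
    and "\<forall>i<k. f i \<in> S \<and> f i $ p i \<noteq> 0 \<and> (\<forall>j<i. f i $ p j = 0)"
    and g: "g \<in> S" "\<forall>i<k. g $ p i = 0"
    and h: "h \<in> S" "\<forall>i<k. h $ p i = 0"
  shows "g $ x * h $ y = g $ y * h $ x"
proof (cases "g $ x = 0 \<and> g $ y = 0")
  case False
  then obtain z where z: "g $ z \<noteq> 0" by blast
  define T where "T = {h \<in> S. \<forall>i<Suc k. h $ (p(k := z)) i = 0}"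
  \<comment> \<open>Taking \<open>z\<close> as a further pivot, with \<open>g\<close> as its vector,
    uses up the whole dimension.\<close>
  have "dim T + Suc k \<le> dim S"
    unfolding T_def using assms z
    by (intro dim_vanishing_le[where f = "f(k := g)"]) (auto simp: less_Suc_eq)
  then have "dim T = 0"
    using assms(2) by linarith
  then have "T \<subseteq> {0}" by simp
  moreover have "h - (h $ z / g $ z) *\<^sub>R g \<in> T"
    using assms z by (auto simp: T_def less_Suc_eq intro!: subspace_diff subspace_scale)
  ultimately obtain t where "h = t *\<^sub>R g" by auto
  then show ?thesis by simp
qed simp

lemma vanishing_eq_0:
  fixes S :: "(real^'n) set"
  assumes "subspace S" "dim S \<le> k"
    and "\<forall>i<k. f i \<in> S \<and> f i $ p i \<noteq> 0 \<and> (\<forall>j<i. f i $ p j = 0)"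
    and "g \<in> S" "\<forall>i<k. g $ p i = 0"
  shows "g = 0"
proof -
  have "dim {h \<in> S. \<forall>i<k. h $ p i = 0} = 0"
    using dim_vanishing_le[OF assms(1,3)] assms(2) by linarith
  then show ?thesis using assms(4,5) by auto
qed

section \<open>Adjacency matrices and vectors certified by a clique\<close>

locale adjacency =
  fixes A :: "real^'n^'n"
  assumes bit: "A $ i $ j = 0 \<or> A $ i $ j = 1"
    and sym: "A $ i $ j = A $ j $ i"
    and diag: "A $ i $ i = 0"
begin

lemma row_in_span: "A $ i \<in> span (rows A)"
proof -
  have "A $ i = row i A" by (simp add: row_def)
  then show ?thesis by (auto simp: rows_def intro: span_base)
qed

lemmas span_closed = row_in_span span_add span_diff span_scale

definition has_new_vector :: bool where
  "has_new_vector \<longleftrightarrow> (\<exists>x \<in> span (rows A). x \<noteq> 0 \<and> (\<forall>i. x $ i \<in> {0, 1}) \<and> x \<notin> rows A)"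

text \<open>A row equal to 1 on \<open>C\<close> would be the row of a vertex adjacent to all of \<open>C\<close>.\<close>

lemma has_new_vectorI:
  assumes "x \<in> span (rows A)" "\<And>i. x $ i = 0 \<or> x $ i = 1"
    and "C \<noteq> {}" "\<And>p. p \<in> C \<Longrightarrow> x $ p = 1" "\<And>y. \<exists>p\<in>C. A $ y $ p = 0"
  shows has_new_vector
proof -
  have "x \<notin> rows A"
  proof
    assume "x \<in> rows A"
    then obtain y where "x = A $ y" by (auto simp: rows_def row_def)
    then show False using assms(4,5) by (metis zero_neq_one)
  qed
  moreover have "x \<noteq> 0" using assms(3,4) by auto
  ultimately show ?thesis unfolding has_new_vector_def using assms(1,2) by auto
qed

lemma has_new_vector_K2:
  assumes "A $ a $ b = 1" "\<And>y. A $ y $ a = 0 \<or> A $ y $ b = 0"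
  shows has_new_vector
proof (rule has_new_vectorI[where C = "{a, b}" and x = "A $ a + A $ b"])
  show "(A $ a + A $ b) $ i = 0 \<or> (A $ a + A $ b) $ i = 1" for i
    using assms(2)[of i] bit[of a i] bit[of b i] sym[of a i] sym[of b i] by auto
qed (use assms diag sym[of b a] in \<open>auto intro: span_closed\<close>)

section \<open>Cliques with five vertices\<close>

text \<open>The residual of each row vanishes on the clique, hence everywhere by the rank bound. Its
  diagonal entry \<open>K x * (1 - K x / 4)\<close> then allows a vertex only 0 or 4 neighbours in
  the clique.\<close>

lemma has_new_vector_K5:
  assumes r: "rank A \<le> 5"
    and e: "A $ a $ b = 1" "A $ a $ c = 1" "A $ a $ d = 1" "A $ a $ e = 1" "A $ b $ c = 1"
      "A $ b $ d = 1" "A $ b $ e = 1" "A $ c $ d = 1" "A $ c $ e = 1" "A $ d $ e = 1"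
  shows has_new_vector
proof -
  have E: "A $ b $ a = 1" "A $ c $ a = 1" "A $ d $ a = 1" "A $ e $ a = 1" "A $ c $ b = 1"
      "A $ d $ b = 1" "A $ e $ b = 1" "A $ d $ c = 1" "A $ e $ c = 1" "A $ e $ d = 1"
    using e sym by metis+
  define K where "K x = A $ x $ a + A $ x $ b + A $ x $ c + A $ x $ d + A $ x $ e" for x
  \<comment> \<open>The clique has matrix \<open>J - I\<close> with inverse \<open>J/4 - I\<close>;
    the coefficients are this inverse applied to the adjacency vector of \<open>x\<close>.\<close>
  define \<rho> where "\<rho> x = A $ x - ((K x / 4 - A $ x $ a) *\<^sub>R A $ a + (K x / 4 - A $ x $ b) *\<^sub>R A $ b
    + (K x / 4 - A $ x $ c) *\<^sub>R A $ c + (K x / 4 - A $ x $ d) *\<^sub>R A $ d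
    + (K x / 4 - A $ x $ e) *\<^sub>R A $ e)" for x
  have "\<rho> x = 0" for x
  \<comment> \<open>The list \<open>f\<close> comes from eliminating the clique rows; its pivot
    entries are 1, 1, 2, 3, 4.\<close>
  proof (rule vanishing_eq_0[where S = "span (rows A)" and k = 5 and p = "(!) [a, b, c, d, e]" and
      f = "(!) [A $ b, A $ a, A $ a + A $ b - A $ c, A $ a + A $ b + A $ c - 2 *\<^sub>R A $ d,
        A $ a + A $ b + A $ c + A $ d - 3 *\<^sub>R A $ e]"])
    show "dim (span (rows A)) \<le> 5" using r by (simp add: row_rank_def)
    show "\<rho> x \<in> span (rows A)" unfolding \<rho>_def by (intro span_closed)
    show "\<forall>i<5. \<rho> x $ [a, b, c, d, e] ! i = 0"
      by (simp add: eval_nat_numeral All_less_Suc2 \<rho>_def e E diag K_def field_simps)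
  qed (simp_all add: eval_nat_numeral All_less_Suc2 e E diag span_closed)
  then have "\<rho> x $ x = 0" for x by simp
  moreover have "\<rho> x $ x = K x * (1 - K x / 4)" for x
  proof -
    have sq: "A $ x $ p * A $ x $ p = A $ x $ p" for p using bit[of x p] by auto
    have "\<rho> x $ x = (A $ x $ a * A $ x $ a + A $ x $ b * A $ x $ b + A $ x $ c * A $ x $ c
        + A $ x $ d * A $ x $ d + A $ x $ e * A $ x $ e) - K x / 4 *
          (A $ x $ a + A $ x $ b + A $ x $ c + A $ x $ d + A $ x $ e)"
      by (simp add: \<rho>_def sym[of a x] sym[of b x] sym[of c x] sym[of d x] sym[of e x]
          diag algebra_simps)
    then show ?thesis
      unfolding sq K_def[symmetric] by (simp add: algebra_simps)
  qed
  ultimately have K: "K x = 0 \<or> K x = 4" for x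
    by (metis divide_eq_1_iff mult_eq_0_iff eq_iff_diff_eq_0)
  show ?thesis
  proof (rule has_new_vectorI[where C = "{a, b, c, d, e}" and
      x = "(1/4) *\<^sub>R (A $ a + A $ b + A $ c + A $ d + A $ e)"])
    show "((1/4) *\<^sub>R (A $ a + A $ b + A $ c + A $ d + A $ e)) $ i = 0 \<or>
      ((1/4) *\<^sub>R (A $ a + A $ b + A $ c + A $ d + A $ e)) $ i = 1" for i
      using K[of i] by (auto simp: K_def sym[of a i] sym[of b i] sym[of c i] sym[of d i] sym[of e i])
    show "\<exists>p\<in>{a, b, c, d, e}. A $ y $ p = 0" for y
    proof (rule ccontr)
      assume "\<not> (\<exists>p\<in>{a, b, c, d, e}. A $ y $ p = 0)"
      then have "K y = 5"
        using bit[of y a] bit[of y b] bit[of y c] bit[of y d] bit[of y e] by (simp add: K_def)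
      then show False using K[of y] by simp
    qed
    show "(1/4) *\<^sub>R (A $ a + A $ b + A $ c + A $ d + A $ e) \<in> span (rows A)"
      by (intro span_closed)
    show "((1/4) *\<^sub>R (A $ a + A $ b + A $ c + A $ d + A $ e)) $ p = 1" if "p \<in> {a, b, c, d, e}" for p
      using that by (auto simp: e E diag)
  qed simp
qed

text \<open>Vanishing at four pivots leaves at most one dimension for the residual rows, so the
  residual matrix has rank at most 1.\<close>

lemma residual_minor:
  fixes f :: "nat \<Rightarrow> real^'n"
  assumes r: "rank A \<le> 5"
    and f: "\<forall>i<4. f i \<in> span (rows A) \<and> f i $ p i \<noteq> 0 \<and> (\<forall>j<i. f i $ p j = 0)"
    and \<rho>: "\<And>x. \<rho> x \<in> span (rows A)" "\<And>x. \<forall>i<4. \<rho> x $ p i = 0"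
  shows "\<rho> x $ x * \<rho> y $ y = \<rho> x $ y * \<rho> y $ x"
proof (rule vanishing_proportional[OF subspace_span _ f \<rho> \<rho>])
  show "dim (span (rows A)) \<le> Suc 4" using r by (simp add: row_rank_def)
qed

section \<open>Cliques with four vertices\<close>

definition K4 :: "'n \<Rightarrow> 'n \<Rightarrow> 'n \<Rightarrow> 'n \<Rightarrow> bool" where
  "K4 a b c d \<longleftrightarrow> A $ a $ b = 1 \<and> A $ a $ c = 1 \<and> A $ a $ d = 1 \<and>
    A $ b $ c = 1 \<and> A $ b $ d = 1 \<and> A $ c $ d = 1"

definition K4_deg :: "'n \<Rightarrow> 'n \<Rightarrow> 'n \<Rightarrow> 'n \<Rightarrow> 'n \<Rightarrow> real" where
  "K4_deg a b c d x = A $ x $ a + A $ x $ b + A $ x $ c + A $ x $ d"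

text \<open>The matrix of \<open>K\<^sub>4\<close> is \<open>J - I\<close>, with inverse \<open>J/3 - I\<close>.\<close>

definition K4_res :: "'n \<Rightarrow> 'n \<Rightarrow> 'n \<Rightarrow> 'n \<Rightarrow> 'n \<Rightarrow> 'n \<Rightarrow> real" where
  "K4_res a b c d x y = A $ x $ y - K4_deg a b c d x * K4_deg a b c d y / 3
    + A $ x $ a * A $ y $ a + A $ x $ b * A $ y $ b + A $ x $ c * A $ y $ c + A $ x $ d * A $ y $ d"

lemma K4_edges:
  assumes "K4 a b c d"
  shows "A $ a $ b = 1" "A $ a $ c = 1" "A $ a $ d = 1" "A $ b $ c = 1" "A $ b $ d = 1" "A $ c $ d = 1"
    "A $ b $ a = 1" "A $ c $ a = 1" "A $ d $ a = 1" "A $ c $ b = 1" "A $ d $ b = 1" "A $ d $ c = 1"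
  using assms sym unfolding K4_def by metis+

text \<open>Together with the identity, these orders bring any one vertex to the first place and any
  two to the first two.\<close>

lemma K4_perms:
  assumes "K4 a b c d"
  shows "K4 b a c d" "K4 c b a d" "K4 d b c a" "K4 a c b d"
    "K4 a d c b" "K4 b c a d" "K4 b d c a" "K4 c d a b"
  using K4_edges[OF assms] by (simp_all add: K4_def)

lemma K4_res_sq:
  assumes r: "rank A \<le> 5" and K: "K4 a b c d"
  shows "(K4_res a b c d x y)\<^sup>2 = K4_res a b c d x x * K4_res a b c d y y"
proof -
  note E = K4_edges[OF K] diag
  define k where "k = K4_deg a b c d"
  \<comment> \<open>What is subtracted is the combination of clique rows that agrees with row
    \<open>x\<close> on the clique.\<close>
  define \<rho> where "\<rho> x = A $ x - ((k x / 3 - A $ x $ a) *\<^sub>R A $ a + (k x / 3 - A $ x $ b) *\<^sub>R A $ b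
    + (k x / 3 - A $ x $ c) *\<^sub>R A $ c + (k x / 3 - A $ x $ d) *\<^sub>R A $ d)" for x
  have res: "\<rho> x $ y = K4_res a b c d x y" for x y
    by (simp add: \<rho>_def K4_res_def k_def K4_deg_def sym[of a y] sym[of b y] sym[of c y] sym[of d y]
        field_simps)
  have "\<rho> x $ x * \<rho> y $ y = \<rho> x $ y * \<rho> y $ x" for x y
  proof (rule residual_minor[OF r, where p = "(!) [a, b, c, d]" and
      f = "(!) [A $ b, A $ a, A $ a + A $ b - A $ c, A $ a + A $ b + A $ c - 2 *\<^sub>R A $ d]"])
    show "\<rho> x \<in> span (rows A)" for x unfolding \<rho>_def by (intro span_closed)
    show "\<forall>i<4. \<rho> x $ [a, b, c, d] ! i = 0" for x
      by (simp add: eval_nat_numeral All_less_Suc2 \<rho>_def E k_def K4_deg_def field_simps)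
  qed (simp add: eval_nat_numeral All_less_Suc2 E span_closed)
  moreover have "K4_res a b c d y x = K4_res a b c d x y"
    by (simp add: K4_res_def sym[of x y])
  ultimately show ?thesis
    unfolding res power2_eq_square by metis
qed

lemma has_new_vector_K4_one:
  assumes r: "rank A \<le> 5" and K: "K4 a b c d"
    and no5: "\<And>y. \<exists>p\<in>{a, b, c, d}. A $ y $ p = 0"
    and e: "A $ e $ a = 1" "A $ e $ b = 0" "A $ e $ c = 0" "A $ e $ d = 0"
  shows has_new_vector
proof (rule has_new_vectorI[where C = "{a, b, c, d}" and x = "A $ e + A $ a"])
  fix x
  \<comment> \<open>The sum is \<open>K4_deg a b c d x / 3\<close> plus the residual at
    \<open>(e, x)\<close>. That residual is 0 if \<open>x\<close> has 0 or 3 neighbours in the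
    clique, and 2/3 or -2/3 if it has 1 or 2; only one sign gives an integer.\<close>
  have "A $ e $ x + A $ x $ a = 0 \<or> A $ e $ x + A $ x $ a = 1"
    using K4_res_sq[OF r K, of e x] no5[of x]
      bit[of e x] bit[of x a] bit[of x b] bit[of x c] bit[of x d]
    by (elim disjE) (simp_all add: e diag K4_res_def K4_deg_def power2_eq_square)
  then show "(A $ e + A $ a) $ x = 0 \<or> (A $ e + A $ a) $ x = 1"
    by (simp add: sym[of a x])
  show "A $ e + A $ a \<in> span (rows A)"
    by (intro span_closed)
  show "(A $ e + A $ a) $ p = 1" if "p \<in> {a, b, c, d}" for p
    using that by (auto simp: e K4_edges[OF K] diag)
qed (use no5 in auto)

lemma has_new_vector_K4_two:
  assumes r: "rank A \<le> 5" and K: "K4 a b c d"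
    and no5: "\<And>y. \<exists>p\<in>{a, b, c, d}. A $ y $ p = 0"
    and e: "A $ e $ a = 1" "A $ e $ b = 1" "A $ e $ c = 0" "A $ e $ d = 0"
  shows has_new_vector
proof (rule has_new_vectorI[where C = "{a, b, c, d}" and x = "(1/2) *\<^sub>R (A $ e + A $ a + A $ b)"])
  fix x
  \<comment> \<open>Here the sum is \<open>2 * K4_deg a b c d x / 3\<close> plus a residual with the
    same possible values, and integrality again decides.\<close>
  have "A $ e $ x + A $ x $ a + A $ x $ b = 0 \<or> A $ e $ x + A $ x $ a + A $ x $ b = 2"
    using K4_res_sq[OF r K, of e x] no5[of x]
      bit[of e x] bit[of x a] bit[of x b] bit[of x c] bit[of x d]
    by (elim disjE) (simp_all add: e diag K4_res_def K4_deg_def power2_eq_square)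
  then show "((1/2) *\<^sub>R (A $ e + A $ a + A $ b)) $ x = 0 \<or>
      ((1/2) *\<^sub>R (A $ e + A $ a + A $ b)) $ x = 1"
    by (auto simp: sym[of a x] sym[of b x])
  show "(1/2) *\<^sub>R (A $ e + A $ a + A $ b) \<in> span (rows A)"
    by (intro span_closed)
  show "((1/2) *\<^sub>R (A $ e + A $ a + A $ b)) $ p = 1" if "p \<in> {a, b, c, d}" for p
    using that by (auto simp: e K4_edges[OF K] diag)
qed (use no5 in auto)

lemma has_new_vector_K4:
  assumes r: "rank A \<le> 5" and K: "K4 a b c d"
    and no5: "\<And>y. \<exists>p\<in>{a, b, c, d}. A $ y $ p = 0"
  shows has_new_vector
proof (cases "\<forall>x. K4_deg a b c d x = 0 \<or> K4_deg a b c d x = 3")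
  case True
  show ?thesis
  proof (rule has_new_vectorI[where C = "{a, b, c, d}" and
      x = "(1/3) *\<^sub>R (A $ a + A $ b + A $ c + A $ d)"])
    fix x
    show "((1/3) *\<^sub>R (A $ a + A $ b + A $ c + A $ d)) $ x = 0 \<or>
        ((1/3) *\<^sub>R (A $ a + A $ b + A $ c + A $ d)) $ x = 1"
      using True[rule_format, of x] by (auto simp: K4_deg_def sym[of a x] sym[of b x] sym[of c x] sym[of d x])
    show "(1/3) *\<^sub>R (A $ a + A $ b + A $ c + A $ d) \<in> span (rows A)"
      by (intro span_closed)
    show "((1/3) *\<^sub>R (A $ a + A $ b + A $ c + A $ d)) $ p = 1" if "p \<in> {a, b, c, d}" for p
      using that by (auto simp: K4_edges[OF K] diag)
  qed (use no5 in auto)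
next
  case False
  \<comment> \<open>As \<open>no5\<close> excludes four neighbours, \<open>e\<close> has one or two;
    a relabelling puts them first.\<close>
  then obtain e where e: "K4_deg a b c d e \<noteq> 0" "K4_deg a b c d e \<noteq> 3" by blast
  have no: "\<exists>p\<in>{b, a, c, d}. A $ y $ p = 0" "\<exists>p\<in>{c, b, a, d}. A $ y $ p = 0"
     "\<exists>p\<in>{d, b, c, a}. A $ y $ p = 0" "\<exists>p\<in>{a, c, b, d}. A $ y $ p = 0"
     "\<exists>p\<in>{a, d, c, b}. A $ y $ p = 0"
     "\<exists>p\<in>{b, c, a, d}. A $ y $ p = 0" "\<exists>p\<in>{b, d, c, a}. A $ y $ p = 0" "\<exists>p\<in>{c, d, a, b}. A $ y $ p = 0" for y
    using no5[of y] by auto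
  note P = K4_perms[OF K]
  show ?thesis
    using has_new_vector_K4_one[OF r K no5, of e] has_new_vector_K4_one[OF r P(1) no(1), of e]
      has_new_vector_K4_one[OF r P(2) no(2), of e] has_new_vector_K4_one[OF r P(3) no(3), of e]
      has_new_vector_K4_two[OF r K no5, of e] has_new_vector_K4_two[OF r P(4) no(4), of e]
      has_new_vector_K4_two[OF r P(5) no(5), of e] has_new_vector_K4_two[OF r P(6) no(6), of e]
      has_new_vector_K4_two[OF r P(7) no(7), of e] has_new_vector_K4_two[OF r P(8) no(8), of e]
      no5[of e] e bit[of e a] bit[of e b] bit[of e c] bit[of e d]
    unfolding K4_deg_def by (elim disjE) simp_all
qed

section \<open>Triangles\<close>

definition paw :: "'n \<Rightarrow> 'n \<Rightarrow> 'n \<Rightarrow> 'n \<Rightarrow> bool" where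
  "paw a b c d \<longleftrightarrow> A $ a $ b = 1 \<and> A $ a $ c = 1 \<and> A $ b $ c = 1 \<and>
    A $ d $ a = 1 \<and> A $ d $ b = 0 \<and> A $ d $ c = 0"

text \<open>The form given by the inverse of the adjacency matrix of the paw.\<close>

definition paw_form :: "'n \<Rightarrow> 'n \<Rightarrow> 'n \<Rightarrow> 'n \<Rightarrow> 'n \<Rightarrow> 'n \<Rightarrow> real" where
  "paw_form a b c d x y = A $ x $ d * A $ y $ a + (A $ x $ c - A $ x $ d) * A $ y $ b
    + (A $ x $ b - A $ x $ d) * A $ y $ c
    + (A $ x $ a - A $ x $ b - A $ x $ c + 2 * A $ x $ d) * A $ y $ d"

lemma paw_edges:
  assumes "paw a b c d"
  shows "A $ a $ b = 1" "A $ a $ c = 1" "A $ b $ c = 1" "A $ d $ a = 1" "A $ d $ b = 0" "A $ d $ c = 0"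
    "A $ b $ a = 1" "A $ c $ a = 1" "A $ c $ b = 1" "A $ a $ d = 1" "A $ b $ d = 0" "A $ c $ d = 0"
  using assms sym unfolding paw_def by metis+

text \<open>On the diagonal the residual is minus the form, because \<open>A\<close> has zero
  diagonal; the two signs cancel in the product.\<close>

lemma paw_res_sq:
  assumes r: "rank A \<le> 5" and P: "paw a b c d"
  shows "(A $ x $ y - paw_form a b c d x y)\<^sup>2 = paw_form a b c d x x * paw_form a b c d y y"
proof -
  note E = paw_edges[OF P] diag
  define \<rho> where "\<rho> x = A $ x - (A $ x $ d *\<^sub>R A $ a + (A $ x $ c - A $ x $ d) *\<^sub>R A $ b
    + (A $ x $ b - A $ x $ d) *\<^sub>R A $ c
    + (A $ x $ a - A $ x $ b - A $ x $ c + 2 * A $ x $ d) *\<^sub>R A $ d)" for x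
  have res: "\<rho> x $ y = A $ x $ y - paw_form a b c d x y" for x y
    by (simp add: \<rho>_def paw_form_def sym[of a y] sym[of b y] sym[of c y] sym[of d y])
  have "\<rho> x $ x * \<rho> y $ y = \<rho> x $ y * \<rho> y $ x" for x y
  proof (rule residual_minor[OF r, where p = "(!) [d, a, b, c]" and
      f = "(!) [A $ a, A $ d, A $ c - A $ d, A $ b - A $ d]"])
    show "\<rho> x \<in> span (rows A)" for x unfolding \<rho>_def by (intro span_closed)
    show "\<forall>i<4. \<rho> x $ [d, a, b, c] ! i = 0" for x
      by (simp add: eval_nat_numeral All_less_Suc2 \<rho>_def E)
  qed (simp add: eval_nat_numeral All_less_Suc2 E span_closed)
  moreover have "paw_form a b c d y x = paw_form a b c d x y"
    by (simp add: paw_form_def algebra_simps)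
  ultimately show ?thesis
    unfolding res power2_eq_square by (simp add: diag sym[of y x])
qed

lemma has_new_vector_triangleI:
  assumes "A $ a $ b = 1" "A $ a $ c = 1" "A $ b $ c = 1"
    and "\<And>y. A $ y $ a = 0 \<or> A $ y $ b = 0 \<or> A $ y $ c = 0"
    and v: "v \<in> span (rows A)" "\<And>x. v $ x = 0 \<or> v $ x = 1"
    and "v $ a = 1" "v $ b = 1" "v $ c = 1"
  shows has_new_vector
  using assms by (intro has_new_vectorI[OF v, where C = "{a, b, c}"]) auto

lemma has_new_vector_paw:
  assumes r: "rank A \<le> 5" and P: "paw a b c d"
    and no4: "\<And>y. A $ y $ a = 0 \<or> A $ y $ b = 0 \<or> A $ y $ c = 0"
  shows has_new_vector
proof -
  note E = paw_edges[OF P] diag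
  note T = has_new_vector_triangleI[OF E(1-3) no4]
  note sq = paw_res_sq[OF r P, unfolded paw_form_def power2_eq_square]
  let ?type = "\<lambda>e. (A $ e $ a, A $ e $ b, A $ e $ c, A $ e $ d)"
  \<comment> \<open>These are the types of non-isotropic vertices. In each case \<open>v\<close> is the combination of
    the rows of \<open>b\<close>, \<open>c\<close>, \<open>d\<close> with coefficients \<open>1, 1, -1\<close>, corrected by a multiple of
    the residual of \<open>e\<close>.\<close>
  have new: has_new_vector
    if e: "?type e \<in> {(1,0,0,1), (0,1,1,0), (0,0,0,1), (1,1,0,1), (1,0,1,1)}" for e
  proof -
    define v where "v =
      (if A $ e $ d = 0 then (1/2) *\<^sub>R (A $ b + A $ c + A $ e)
       else if A $ e $ a = 0 then (1/2) *\<^sub>R (A $ a + A $ b + A $ c - A $ e)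
       else if A $ e $ b = 1 then A $ c + (1/2) *\<^sub>R (A $ a + A $ b - A $ e)
       else if A $ e $ c = 1 then A $ b + (1/2) *\<^sub>R (A $ a + A $ c - A $ e)
       else A $ b + A $ c - A $ d - (1/4) *\<^sub>R (A $ e - A $ a + A $ b + A $ c - 3 *\<^sub>R A $ d))"
    have type_cases: "?type e = (1,0,0,1) \<or> ?type e = (0,1,1,0) \<or> ?type e = (0,0,0,1) \<or>
        ?type e = (1,1,0,1) \<or> ?type e = (1,0,1,1)"
      using e by simp
    show ?thesis
    proof (rule T)
      show "v \<in> span (rows A)" by (simp add: v_def span_closed)
      \<comment> \<open>The form is at least 2 at \<open>e\<close>, and 0 or at least 2 at
        \<open>x\<close>. So \<open>sq\<close> leaves one value for \<open>A $ e $ x\<close>, or two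
        that differ by at least 4, of which at most one is a bit.\<close>
      show "v $ x = 0 \<or> v $ x = 1" for x
        using type_cases sq[of e x] no4[of x]
          bit[of e x] bit[of x a] bit[of x b] bit[of x c] bit[of x d]
        by (elim disjE)
          (simp_all add: v_def sym[of a x] sym[of b x] sym[of c x] sym[of d x] diag)
    qed (use type_cases in \<open>auto simp: v_def E\<close>)
  qed
  show ?thesis
  proof (rule ccontr)
    assume none: "\<not> has_new_vector"
    have has_new_vector
    proof (rule T)
      let ?v = "A $ b + A $ c - A $ d"
      show "?v \<in> span (rows A)" by (intro span_closed)
      \<comment> \<open>By \<open>new\<close> only isotropic types of \<open>x\<close> remain, and
        for them no residual correction is needed.\<close>
      show "?v $ x = 0 \<or> ?v $ x = 1" for x
        using bit[of x a] bit[of x b] bit[of x c] bit[of x d] no4[of x] new[of x] none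
        by (elim disjE) (simp_all add: sym[of a x] sym[of b x] sym[of c x] sym[of d x])
    qed (simp_all add: E)
    then show False using none by blast
  qed
qed

lemma has_new_vector_K3:
  assumes r: "rank A \<le> 5" and e: "A $ a $ b = 1" "A $ a $ c = 1" "A $ b $ c = 1"
    and no4: "\<And>y. A $ y $ a = 0 \<or> A $ y $ b = 0 \<or> A $ y $ c = 0"
  shows has_new_vector
proof -
  have E: "A $ b $ a = 1" "A $ c $ a = 1" "A $ c $ b = 1"
    using e sym by metis+
  \<comment> \<open>One disjunct for each triangle vertex that may carry the pendant edge.\<close>
  have new: has_new_vector if "paw a b c d \<or> paw b a c d \<or> paw c a b d" for d
    using that r no4 has_new_vector_paw by metis
  show ?thesis
  proof (rule ccontr)
    assume none: "\<not> has_new_vector"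
    have has_new_vector
    proof (rule has_new_vector_triangleI[OF e no4])
      let ?v = "(1/2) *\<^sub>R (A $ a + A $ b + A $ c)"
      show "?v \<in> span (rows A)" by (intro span_closed)
      show "?v $ x = 0 \<or> ?v $ x = 1" for x
        using bit[of x a] bit[of x b] bit[of x c] no4[of x] new[of x] none
        unfolding paw_def
        by (elim disjE) (simp_all add: e E sym[of a x] sym[of b x] sym[of c x])
    qed (simp_all add: e E diag)
    then show False using none by blast
  qed
qed

section \<open>Growing a clique from an edge\<close>

lemma has_new_vector_edge:
  assumes r: "rank A \<le> 5" and ab: "A $ a $ b = 1"
  shows has_new_vector
proof (cases "\<exists>c. A $ c $ a = 1 \<and> A $ c $ b = 1")
  case True
  then obtain c where c: "A $ c $ a = 1" "A $ c $ b = 1" by blast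
  then have e3: "A $ a $ c = 1" "A $ b $ c = 1" using sym by metis+
  show ?thesis
  proof (cases "\<exists>d. A $ d $ a = 1 \<and> A $ d $ b = 1 \<and> A $ d $ c = 1")
    case True
    then obtain d where d: "A $ d $ a = 1" "A $ d $ b = 1" "A $ d $ c = 1" by blast
    then have e4: "A $ a $ d = 1" "A $ b $ d = 1" "A $ c $ d = 1" using sym by metis+
    show ?thesis
    proof (cases "\<exists>e. \<forall>p\<in>{a, b, c, d}. A $ e $ p = 1")
      case True
      then obtain e where "A $ e $ a = 1" "A $ e $ b = 1" "A $ e $ c = 1" "A $ e $ d = 1" by blast
      then have "A $ a $ e = 1" "A $ b $ e = 1" "A $ c $ e = 1" "A $ d $ e = 1" using sym by metis+
      with r ab e3 e4 show ?thesis by (intro has_new_vector_K5)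
    next
      case False
      then have "\<And>y. \<exists>p\<in>{a, b, c, d}. A $ y $ p = 0" using bit by blast
      with r ab e3 e4 show ?thesis by (intro has_new_vector_K4) (auto simp: K4_def)
    qed
  next
    case False
    then have "\<And>y. A $ y $ a = 0 \<or> A $ y $ b = 0 \<or> A $ y $ c = 0" using bit by blast
    with r ab e3 show ?thesis by (intro has_new_vector_K3)
  qed
next
  case False
  then have "\<And>y. A $ y $ a = 0 \<or> A $ y $ b = 0" using bit by blast
  with ab show ?thesis by (rule has_new_vector_K2)
qed

end

section \<open>From graphs to matrices\<close>

lemma connected_not_complete_imp_arc:
  assumes "graph G" "\<not> complete_graph G" "Digraph_Component.connected G"
  obtains x y where "x \<rightarrow>\<^bsub>G\<^esub> y"
proof -
  interpret graph G by fact
  have "arcs_ends G \<noteq> {(x, y). (x, y) \<in> verts G \<times> verts G \<and> x \<noteq> y}"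
    using assms(1,2) by (simp add: complete_graph_def complete_digraph_def)
  \<comment> \<open>The inclusion is therefore proper, which supplies two distinct vertices; a path
    between them starts with an arc.\<close>
  moreover have "arcs_ends G \<subseteq> {(x, y). (x, y) \<in> verts G \<times> verts G \<and> x \<noteq> y}"
    using adj_not_same by auto
  ultimately obtain x y where xy: "x \<in> verts G" "y \<in> verts G" "x \<noteq> y" by blast
  have "strongly_connected G"
    using symmetric_connected_imp_strongly_connected[OF sym_arcs assms(3)] .
  then have "x \<rightarrow>\<^sup>*\<^bsub>G\<^esub> y" using xy by auto
  then obtain z where "x \<rightarrow>\<^bsub>G\<^esub> z"
    using xy(3) by (cases rule: converse_reachable_cases) auto
  then show thesis by (rule that)
qed

theorem theorem3p2:
  fixes G :: "('a, 'b) pre_digraph"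
    and v :: "'n::finite \<Rightarrow> 'a"
  assumes "graph G"
    and "bij_betw v UNIV (verts G)"
    and "\<not> complete_graph G"
    and "Digraph_Component.connected G"
    and "diam G \<le> 3"
    and "rank (adjacency_matrix G v) \<le> 5"
  shows "\<exists>x \<in> row_space (adjacency_matrix G v).
           x \<noteq> 0 \<and> (\<forall>i. x $ i \<in> {0, 1}) \<and> x \<notin> rows (adjacency_matrix G v)"
proof -
  interpret graph G by fact
  let ?A = "adjacency_matrix G v"
  interpret adjacency ?A
    by unfold_locales (use adj_not_same graph_symmetric in \<open>auto simp: adjacency_matrix_def\<close>)
  obtain x y where xy: "x \<rightarrow>\<^bsub>G\<^esub> y"
    using connected_not_complete_imp_arc assms(1,3,4) .
  then have "x \<in> range v" "y \<in> range v"
    using assms(2) by (auto simp: bij_betw_def)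
  then obtain a b where "?A $ a $ b = 1"
    using xy by (auto simp: adjacency_matrix_def)
  with assms(6) have has_new_vector by (rule has_new_vector_edge)
  then show ?thesis by (simp add: has_new_vector_def row_space_def)
qed

end
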